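(* Let $D$ be a multipartite tournament. Suppose that there exists a $(u,v)$-directed walk of Type 1 of length $\ell$ for some vertices $u$ and $v$. Then there is a $(u,v)$-directed walk of length $\ell+3m$ for each nonnegative integer $m$.
   Context: All digraphs are finite, and the underlying graph of each digraph is simple (no loops, no multiple arcs, no directed cycles of length $2$). A multipartite tournament is an orientation of a complete $k$-partite graph (with $k$ nonempty partite sets) for some integer $k\ge 2$. A $(u,v)$-directed walk is a directed walk from $u$ to $v$. A directed walk in $D$ is of Type 1 if it contains three vertices which induce a directed cycle of length $3$ in $D$. *)

theory Defs
  imports "Graph_Theory.Digraph_Component" "HOL-Library.Disjoint_Sets"
begin

text \<open>
  Digraphs are taken from the AFP entry Graph Theory. The locale predicate \<^const>\<open>digraph\<close> says
  finite, loopless and without parallel arcs; asymmetry of the arc relation excludes directed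
  cycles of length 2.
\<close>

definition simple_digraph :: "('a, 'b) pre_digraph \<Rightarrow> bool" where
  "simple_digraph D \<longleftrightarrow> digraph D \<and> asym (arcs_ends D)"

text \<open>
  As usual in that entry, an undirected graph is a symmetric digraph (\<^const>\<open>graph\<close>).
  The set \<open>P\<close> consists of the partite sets, which are nonempty by \<^const>\<open>partition_on\<close>.
\<close>

definition complete_multipartite_graph :: "nat \<Rightarrow> ('a, 'b) pre_digraph \<Rightarrow> bool" where
  "complete_multipartite_graph k G \<longleftrightarrow> graph G \<and>
     (\<exists>P. partition_on (verts G) P \<and> finite P \<and> card P = k \<and>
       arcs_ends G = {(x, y). x \<in> verts G \<and> y \<in> verts G \<and> \<not> (\<exists>A\<in>P. x \<in> A \<and> y \<in> A)})"

text \<open>\<^term>\<open>mk_symmetric D\<close> is the underlying undirected graph of \<open>D\<close>.\<close>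

definition multipartite_tournament :: "('a, 'b) pre_digraph \<Rightarrow> bool" where
  "multipartite_tournament D \<longleftrightarrow> simple_digraph D \<and>
     (\<exists>k\<ge>2. complete_multipartite_graph k (with_proj (mk_symmetric D)))"

text \<open>
  \<open>H\<close> is, as a digraph, a directed cycle of length \<open>n\<close>: some cycle uses all its vertices and
  all its arcs.
\<close>

definition is_directed_cycle :: "nat \<Rightarrow> ('a, 'b) pre_digraph \<Rightarrow> bool" where
  "is_directed_cycle n H \<longleftrightarrow>
     (\<exists>p. pre_digraph.cycle H p \<and> length p = n \<and> verts H = tail H ` set p \<and> arcs H = set p)"

text \<open>
  A walk is given by its start vertex \<open>u\<close> and its list of arcs \<open>p\<close>. The three vertices may occur
  anywhere on it, not necessarily consecutively.
\<close>

definition type1_walk :: "('a, 'b) pre_digraph \<Rightarrow> 'a \<Rightarrow> 'b awalk \<Rightarrow> 'a \<Rightarrow> bool" where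
  "type1_walk D u p v \<longleftrightarrow> pre_digraph.awalk D u p v \<and>
     (\<exists>S \<subseteq> set (pre_digraph.awalk_verts D u p). card S = 3 \<and> is_directed_cycle 3 (D \<restriction> S))"

end

theory Submission
  imports Defs
begin

text \<open>A walk of Type 1 meets a directed triangle at some vertex \<open>x\<close>. Stopping at
  \<open>x\<close>, going \<open>m\<close> times around the triangle and then resuming the walk adds
  exactly \<open>3 * m\<close> arcs and keeps both ends. \<open>closed_walk_rotate\<close> makes the
  triangle start at \<open>x\<close>, and \<open>closed_walk_repeat\<close> iterates it.\<close>

text \<open>Cut the closed walk just before an arc leaving \<open>x\<close> and swap the two pieces;
  they fit together at \<open>u\<close>.\<close>

lemma (in wf_digraph) closed_walk_rotate:
  assumes "awalk u p u" "x \<in> tail G ` set p"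
  obtains q where "awalk x q x" "length q = length p"
proof -
  obtain p1 e p2 where p: "p = p1 @ e # p2" and x: "x = tail G e"
    using assms(2) by (auto dest: split_list)
  have "awalk u p1 x" "awalk x (e # p2) u"
    using assms(1) x by (auto simp: p awalk_Cons_iff)
  then have "awalk x ((e # p2) @ p1) x"
    by (rule awalk_appendI[rotated])
  then show ?thesis
    by (rule that) (simp add: p)
qed

lemma (in wf_digraph) closed_walk_repeat:
  assumes "awalk x c x"
  shows "\<exists>q. awalk x q x \<and> length q = length c * m"
proof (induction m)
  case 0
  show ?case
    using assms by (intro exI[of _ "[]"]) (auto simp: awalk_def)
next
  case (Suc m)
  then obtain q where "awalk x q x" "length q = length c * m" by blast
  then have "awalk x (c @ q) x" "length (c @ q) = length c * Suc m"
    using assms by (blast intro: awalk_appendI, simp)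
  then show ?case by blast
qed

theorem lemma3p4:
  fixes D :: "('a, 'b) pre_digraph" and u v :: 'a and l m :: nat
  assumes "multipartite_tournament D"
    and "\<exists>p. type1_walk D u p v \<and> length p = l"
  shows "\<exists>q. pre_digraph.awalk D u q v \<and> length q = l + 3 * m"
proof -
  interpret digraph D
    using assms(1) by (simp add: multipartite_tournament_def simple_digraph_def)
  obtain p S where p: "awalk u p v" "length p = l" and S: "S \<subseteq> set (awalk_verts u p)" "card S = 3"
    and cyc: "is_directed_cycle 3 (D \<restriction> S)"
    using assms(2) by (auto simp: type1_walk_def)
  \<comment> \<open>\<open>S\<close> consists of vertices of a walk, hence of \<open>D\<close>. This
    lets the cycle, given in the induced subgraph, be read as a walk in \<open>D\<close>.\<close>
  have sub: "subgraph (D \<restriction> S) D"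
    using order_trans[OF S(1)] p(1)[unfolded awalk_conv]
    by (intro induced_imp_subgraph induced_induce) blast
  interpret H: wf_digraph "D \<restriction> S"
    using sub by (auto simp: subgraph_def)
  \<comment> \<open>The start \<open>w\<close> of the cycle is arbitrary, but every vertex of
    \<open>S\<close> is the tail of an arc of \<open>c\<close>, so \<open>c\<close> can be rotated
    to start at any of them.\<close>
  obtain c w where c: "H.awalk w c w" "length c = 3" "S = tail D ` set c"
    using cyc by (auto simp: is_directed_cycle_def H.cycle_def)
  obtain x where x: "x \<in> S"
    using S(2) by fastforce
  obtain c' where c': "awalk x c' x" "length c' = 3"
    using closed_walk_rotate[OF subgraph_awalk_imp_awalk[OF c(1) sub]] x c(2,3) by metis
  obtain r where r: "awalk x r x" "length r = 3 * m"
    using closed_walk_repeat[OF c'(1)] c'(2) by metis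
  \<comment> \<open>Since \<open>x\<close> lies in \<open>S\<close>, the walk \<open>p\<close>
    visits it and can be cut there to insert \<open>r\<close>.\<close>
  obtain p1 p2 where "p = p1 @ p2" "awalk u p1 x" "awalk x p2 v"
    using awalk_decomp[OF p(1)] S(1) x by blast
  then have "awalk u (p1 @ r @ p2) v" "length (p1 @ r @ p2) = l + 3 * m"
    using r p(2) by (blast intro: awalk_appendI, simp)
  then show ?thesis by blast
qed

end
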